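(* Let $X$ be a real normed linear space, let $\Omega_0,\Omega_1,\dots,\Omega_n\subseteq X$ be nonempty closed convex sets, and let $v_1,\dots,v_n\in X$ be nonzero vectors. Consider the problem $$\text{minimize } S(x):=\sum_{i=1}^nT_{v_i}(x;\Omega_i)\quad\text{subject to }x\in\Omega_0.$$ Suppose that there exists $u\in\operatorname{dom}S\cap\Omega_0$ at which all functions $T_{v_i}(\cdot;\Omega_i)$, $i=1,\dots,n$, are continuous. If $\bar x$ is an optimal solution of the problem, then there exist $x_1^*,\dots,x_n^*\in X^*$ with the following properties: (1) $x_i^*\in N(\tilde x_i;\Omega_i)$, where $\tilde x_i:=\bar x+T_{v_i}(\bar x;\Omega_i)v_i$, for $i=1,\dots,n$. (2) $\langle x_i^*,-v_i\rangle\le1$ for all $i\in I(\bar x)$ and $\langle x_j^*,v_j\rangle=-1$ for all $j\in J(\bar x)$. (3) $-\sum_{i=1}^nx_i^*\in N(\bar x;\Omega_0)$. Moreover, if for $\bar x\in\Omega_0$ (with $\bar x\in\operatorname{dom}S$, so that the points $\tilde x_i$ are defined) there exist $x_1^*,\dots,x_n^*\in X^*$ satisfying (1), (2) and (3), then $\bar x$ is an optimal solution of the problem.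
   Context: For a nonempty closed set $\Omega\subseteq X$ and nonzero $v\in X$, $T_v(x;\Omega):=\inf\{t\ge0\mid x+tv\in\Omega\}\in[0,\infty]$, with $\inf\emptyset=\infty$; when this is finite, $x+T_v(x;\Omega)v\in\Omega$. $\operatorname{dom}S:=\{x\mid S(x)<\infty\}$. $I(\bar x):=\{i\in\{1,\dots,n\}\mid\bar x\in\Omega_i\}$ and $J(\bar x):=\{i\in\{1,\dots,n\}\mid\bar x\notin\Omega_i\}$. An optimal solution is a point of $\Omega_0$ minimizing $S$ over $\Omega_0$. For a convex set $\Omega$ and $y\in\Omega$, $N(y;\Omega)=\{x^*\in X^*\mid\langle x^*,x-y\rangle\le0\ \forall x\in\Omega\}$. *)

theory Defs
  imports "HOL-Analysis.Analysis"
begin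

text \<open>Values lie in \<open>[0, \<infinity>]\<close>; the infimum of the empty set in type \<^typ>\<open>ereal\<close> is \<open>\<infinity>\<close>.\<close>

definition min_time :: "'a::real_normed_vector \<Rightarrow> 'a set \<Rightarrow> 'a \<Rightarrow> ereal" where
  "min_time v \<Omega> x = Inf {ereal t |t. 0 \<le> t \<and> x + t *\<^sub>R v \<in> \<Omega>}"

definition total_time ::
    "nat \<Rightarrow> (nat \<Rightarrow> 'a::real_normed_vector) \<Rightarrow> (nat \<Rightarrow> 'a set) \<Rightarrow> 'a \<Rightarrow> ereal" where
  "total_time n v \<Omega> x = (\<Sum>i=1..n. min_time (v i) (\<Omega> i) x)"

definition eff_dom :: "('a \<Rightarrow> ereal) \<Rightarrow> 'a set" where
  "eff_dom f = {x. f x < \<infinity>}"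

definition optimal_solution :: "('a \<Rightarrow> ereal) \<Rightarrow> 'a set \<Rightarrow> 'a \<Rightarrow> bool" where
  "optimal_solution f C x \<longleftrightarrow> is_arg_min f (\<lambda>y. y \<in> C) x"

text \<open>Elements of the topological dual are bounded linear functionals. The definition is only
  meaningful for convex \<open>\<Omega>\<close> and \<open>y \<in> \<Omega>\<close>.\<close>

definition normal_cone :: "'a::real_normed_vector \<Rightarrow> 'a set \<Rightarrow> ('a \<Rightarrow>\<^sub>L real) set" where
  "normal_cone y \<Omega> = {x'. \<forall>x\<in>\<Omega>. blinfun_apply x' (x - y) \<le> 0}"

definition idx_in :: "nat \<Rightarrow> (nat \<Rightarrow> 'a set) \<Rightarrow> 'a \<Rightarrow> nat set" where
  "idx_in n \<Omega> x = {i \<in> {1..n}. x \<in> \<Omega> i}"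

definition idx_out :: "nat \<Rightarrow> (nat \<Rightarrow> 'a set) \<Rightarrow> 'a \<Rightarrow> nat set" where
  "idx_out n \<Omega> x = {i \<in> {1..n}. x \<notin> \<Omega> i}"

text \<open>\<^const>\<open>real_of_ereal\<close> sends \<open>\<infinity>\<close> to \<open>0\<close>, so this is the intended point only where
  \<^const>\<open>min_time\<close> is finite.\<close>

definition hit_point :: "'a::real_normed_vector \<Rightarrow> 'a set \<Rightarrow> 'a \<Rightarrow> 'a" where
  "hit_point v \<Omega> x = x + real_of_ereal (min_time v \<Omega> x) *\<^sub>R v"

definition multiplier_conditions ::
    "nat \<Rightarrow> (nat \<Rightarrow> 'a::real_normed_vector) \<Rightarrow> (nat \<Rightarrow> 'a set) \<Rightarrow> 'a \<Rightarrow> (nat \<Rightarrow> 'a \<Rightarrow>\<^sub>L real) \<Rightarrow> bool"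
where
  "multiplier_conditions n v \<Omega> x x' \<longleftrightarrow>
     (\<forall>i\<in>{1..n}. x' i \<in> normal_cone (hit_point (v i) (\<Omega> i) x) (\<Omega> i)) \<and>
     (\<forall>i\<in>idx_in n \<Omega> x. blinfun_apply (x' i) (- v i) \<le> 1) \<and>
     (\<forall>j\<in>idx_out n \<Omega> x. blinfun_apply (x' j) (v j) = -1) \<and>
     - (\<Sum>i=1..n. x' i) \<in> normal_cone x (\<Omega> 0)"

end

theory Submission
  imports Defs
begin

text \<open>The multipliers are subgradients at the optimal point:
  \<open>x\<^sub>i\<^sup>*\<close> satisfies (1) and (2) exactly when it is a subgradient of
  \<open>T(\<cdot>; \<Omega>\<^sub>i)\<close>, as one sees by testing the subgradient inequality at points \<open>w - T v\<close> with
  \<open>w \<in> \<Omega>\<^sub>i\<close> and on the line through the point in direction \<open>v\<^sub>i\<close>. Sufficiency is then the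
  sum of the subgradient inequalities. Necessity is the subdifferential sum rule, which under the
  continuity assumption at \<open>u\<close> follows from the Hahn-Banach theorem.\<close>

section \<open>Linear minorants of sublinear functionals\<close>

text \<open>Homogeneity is stated as an inequality because infimum constructions yield only that
  half directly. Applying it with \<open>inverse t\<close> gives the other half.\<close>

definition sublinear :: "('a::real_vector \<Rightarrow> real) \<Rightarrow> bool" where
  "sublinear p \<longleftrightarrow> (\<forall>x y. p (x + y) \<le> p x + p y) \<and> (\<forall>t>0. \<forall>x. p (t *\<^sub>R x) \<le> t * p x)"

lemma sublinearI:
  assumes "\<And>x y. p (x + y) \<le> p x + p y" "\<And>t x. t > 0 \<Longrightarrow> p (t *\<^sub>R x) \<le> t * p x"
  shows "sublinear p"
  using assms by (simp add: sublinear_def)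

lemma sublinear_add: "sublinear p \<Longrightarrow> p (x + y) \<le> p x + p y"
  by (simp add: sublinear_def)

lemma sublinear_scaleR:
  assumes "sublinear p" "t > 0"
  shows "p (t *\<^sub>R x) = t * p x"
proof (rule antisym)
  show "p (t *\<^sub>R x) \<le> t * p x"
    using assms by (simp add: sublinear_def)
  have "p (inverse t *\<^sub>R (t *\<^sub>R x)) \<le> inverse t * p (t *\<^sub>R x)"
    using assms unfolding sublinear_def by (metis inverse_positive_iff_positive)
  with assms(2) show "t * p x \<le> p (t *\<^sub>R x)"
    by (simp add: field_simps)
qed

lemma sublinear_zero: "sublinear p \<Longrightarrow> p 0 = 0"
  using sublinear_scaleR[of p 2 0] by simp

lemma sublinear_minus_le: "sublinear p \<Longrightarrow> - p (- x) \<le> p x"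
  using sublinear_add[of p x "- x"] sublinear_zero[of p] by simp

text \<open>Supplies the lower bounds for Zorn's lemma. A pointwise infimum of sublinear functionals
  need not be subadditive. In a chain it is, since the smaller of \<open>q\<close> and
  \<open>q'\<close> handles both arguments at once.\<close>

lemma sublinear_Inf_chain:
  fixes C :: "('a::real_vector \<Rightarrow> real) set"
  assumes sub: "\<And>q. q \<in> C \<Longrightarrow> sublinear q" and bound: "\<And>q. q \<in> C \<Longrightarrow> q \<le> p" and "C \<noteq> {}"
    and chain: "\<And>q q'. q \<in> C \<Longrightarrow> q' \<in> C \<Longrightarrow> q \<le> q' \<or> q' \<le> q"
  defines "m \<equiv> \<lambda>x. INF q\<in>C. q x"
  shows "sublinear m" and "\<And>q. q \<in> C \<Longrightarrow> m \<le> q"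
proof -
  \<comment> \<open>This bound does not depend on \<open>q\<close>, so the real infimum defining
    \<open>m\<close> is a genuine greatest lower bound.\<close>
  have "- p (- x) \<le> q x" if "q \<in> C" for q x
    using sublinear_minus_le[OF sub[OF that], of x] bound[OF that] by (meson le_funD neg_le_iff_le order_trans)
  then have bdd: "bdd_below ((\<lambda>q. q x) ` C)" for x
    by (auto intro!: bdd_belowI2)
  have m_le: "m x \<le> q x" if "q \<in> C" for q x
    unfolding m_def using bdd that by (rule cINF_lower)
  have m_ge: "c \<le> m x" if "\<And>q. q \<in> C \<Longrightarrow> c \<le> q x" for c x
    unfolding m_def using \<open>C \<noteq> {}\<close> that by (rule cINF_greatest)
  show "m \<le> q" if "q \<in> C" for q
    using m_le[OF that] by (simp add: le_fun_def)
  show "sublinear m"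
  proof (rule sublinearI)
    fix x y
    have "m (x + y) \<le> q x + q' y" if q: "q \<in> C" "q' \<in> C" for q q'
    proof -
      obtain s where "s \<in> C" "s \<le> q" "s \<le> q'"
        using chain[OF q] q by auto
      then show ?thesis
        using m_le[of s "x + y"] sublinear_add[OF sub, of s x y] by (smt (verit) le_funD)
    qed
    \<comment> \<open>Moving one term to the left lets the two infima be taken one after the
      other.\<close>
    then have "m (x + y) - q x \<le> m y" if "q \<in> C" for q
      using that by (intro m_ge) (fastforce simp: diff_le_eq add.commute)
    then have "m (x + y) - m y \<le> m x"
      by (intro m_ge) (simp add: algebra_simps)
    then show "m (x + y) \<le> m x + m y"
      by simp
  next
    fix t :: real and x assume t: "t > 0"
    have "m (t *\<^sub>R x) / t \<le> m x"
      using m_le[of _ "t *\<^sub>R x"] sublinear_scaleR[OF sub t] t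
      by (intro m_ge) (simp add: field_simps)
    with t show "m (t *\<^sub>R x) \<le> t * m x"
      by (simp add: field_simps)
  qed
qed

lemma minimal_sublinear_minus:
  fixes q :: "'a::real_vector \<Rightarrow> real"
  assumes q: "sublinear q" and min: "\<And>q'. sublinear q' \<Longrightarrow> q' \<le> q \<Longrightarrow> q' = q"
  shows "q (- y) = - q y"
proof -
  \<comment> \<open>\<open>s\<close> is sublinear and below \<open>q\<close>, hence equal to \<open>q\<close>; taking \<open>t = 1\<close> gives
    \<open>q (- y) = s (- y) \<le> q 0 - q y\<close>.\<close>
  define h where "h x t = q (x + t *\<^sub>R y) - t * q y" for x t
  define s where "s x = (INF t\<in>{0..}. h x t)" for x
  \<comment> \<open>Keeps the infimum \<open>s x\<close> finite: \<open>t *\<^sub>R y\<close> is the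
    sum of \<open>x + t *\<^sub>R y\<close> and \<open>- x\<close>, and \<open>q\<close> is
    subadditive.\<close>
  have "- q (- x) \<le> h x t" if "t \<ge> 0" for x t
  proof (cases "t = 0")
    case True
    then show ?thesis
      using sublinear_minus_le[OF q, of x] by (simp add: h_def)
  next
    case False
    with that have "q (t *\<^sub>R y) = t * q y"
      by (intro sublinear_scaleR[OF q]) simp
    then show ?thesis
      using sublinear_add[OF q, of "x + t *\<^sub>R y" "- x"] by (simp add: h_def)
  qed
  then have bdd: "bdd_below (h x ` {0..})" for x
    by (auto intro!: bdd_belowI2)
  have s_le: "s x \<le> h x t" if "t \<ge> 0" for x t
    unfolding s_def using bdd that by (intro cINF_lower) auto
  have s_ge: "c \<le> s x" if "\<And>t. t \<ge> 0 \<Longrightarrow> c \<le> h x t" for c x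
    unfolding s_def using that by (intro cINF_greatest) auto
  have "sublinear s"
  proof (rule sublinearI)
    fix x z
    have "s (x + z) \<le> h x a + h z b" if "a \<ge> 0" "b \<ge> 0" for a b
      using s_le[of "a + b" "x + z"] that sublinear_add[OF q, of "x + a *\<^sub>R y" "z + b *\<^sub>R y"]
      by (simp add: h_def algebra_simps)
    then have "s (x + z) - h x a \<le> s z" if "a \<ge> 0" for a
      using that by (intro s_ge) (simp add: diff_le_eq add.commute)
    then have "s (x + z) - s z \<le> s x"
      by (intro s_ge) (simp add: algebra_simps)
    then show "s (x + z) \<le> s x + s z"
      by simp
  next
    fix t :: real and x assume t: "t > 0"
    \<comment> \<open>Rescaling the parameter along with the point turns homogeneity of
      \<open>q\<close> into homogeneity of the infimum.\<close>
    have "h (t *\<^sub>R x) (t * a) = t * h x a" for a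
      using sublinear_scaleR[OF q t, of "x + a *\<^sub>R y"] by (simp add: h_def algebra_simps)
    then have "s (t *\<^sub>R x) \<le> t * h x a" if "a \<ge> 0" for a
      using s_le[of "t * a" "t *\<^sub>R x"] t that by simp
    then have "s (t *\<^sub>R x) / t \<le> s x"
      using t by (intro s_ge) (simp add: field_simps)
    with t show "s (t *\<^sub>R x) \<le> t * s x"
      by (simp add: field_simps)
  qed
  moreover have "s \<le> q"
    using s_le[of 0] by (simp add: le_fun_def h_def)
  ultimately have "s = q"
    by (rule min)
  then have "q (- y) \<le> - q y"
    using s_le[of 1 "- y"] sublinear_zero[OF q] by (simp add: h_def)
  then show ?thesis
    using sublinear_minus_le[OF q, of y] by linarith
qed

lemma sublinear_odd_imp_linear:
  fixes q :: "'a::real_vector \<Rightarrow> real"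
  assumes q: "sublinear q" and minus: "\<And>y. q (- y) = - q y"
  shows "linear q"
proof (rule linearI)
  fix x y
  show "q (x + y) = q x + q y"
    using sublinear_add[OF q, of x y] sublinear_add[OF q, of "x + y" "- y"] minus[of y] by simp
next
  fix t :: real and x
  consider "t > 0" | "t = 0" | "- t > 0" by linarith
  then show "q (t *\<^sub>R x) = t *\<^sub>R q x"
  proof cases
    case 1
    then show ?thesis by (simp add: sublinear_scaleR[OF q])
  next
    case 2
    then show ?thesis by (simp add: sublinear_zero[OF q])
  next
    case 3
    then show ?thesis
      using sublinear_scaleR[OF q 3, of x] minus[of "t *\<^sub>R x"] by simp
  qed
qed

text \<open>Instead of extending functionals from subspaces, Zorn's lemma for the reversed pointwise
  order gives a minimal sublinear functional below \<open>p\<close>. Minimality makes it odd, and an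
  odd sublinear functional is linear.\<close>

theorem Hahn_Banach_sublinear:
  fixes p :: "'a::real_vector \<Rightarrow> real"
  assumes p: "sublinear p"
  obtains L where "linear L" "\<And>x. L x \<le> p x"
proof -
  define A where "A = {q. sublinear q \<and> q \<le> p}"
  let ?R = "relation_of (\<ge>) A"
  have "\<exists>m\<in>A. \<forall>q\<in>A. m \<ge> q \<longrightarrow> q = m"
  proof (rule predicate_Zorn)
    show "partial_order_on A ?R"
      by (rule partial_order_on_relation_ofI) auto
  next
    fix C assume C: "C \<in> Chains ?R"
    show "\<exists>m\<in>A. \<forall>q\<in>C. q \<ge> m"
    \<comment> \<open>The empty chain is bounded by \<open>p\<close> itself; an infimum over no
      functionals would be meaningless.\<close>
    proof (cases "C = {}")
      case True
      then show ?thesis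
        using p by (auto simp: A_def)
    next
      case False
      have CA: "C \<subseteq> A" and chain: "\<And>q q'. q \<in> C \<Longrightarrow> q' \<in> C \<Longrightarrow> q \<le> q' \<or> q' \<le> q"
        using C by (auto simp: Chains_def relation_of_def)
      define m where "m = (\<lambda>x. INF q\<in>C. q x)"
      have "sublinear m" and le: "\<And>q. q \<in> C \<Longrightarrow> m \<le> q"
        unfolding m_def
        using sublinear_Inf_chain[of C p, OF _ _ False chain] CA by (auto simp: A_def)
      moreover have "m \<le> p"
        using le CA False by (force simp: A_def intro: order_trans)
      ultimately show ?thesis
        by (auto simp: A_def)
    qed
  qed
  then obtain m where m: "sublinear m" "m \<le> p"
    and min: "\<And>q. sublinear q \<Longrightarrow> q \<le> m \<Longrightarrow> q = m"
    unfolding A_def by (auto intro: order_trans)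
  show ?thesis
  proof (rule that)
    show "linear m"
      using m(1) minimal_sublinear_minus[OF m(1) min] by (rule sublinear_odd_imp_linear)
    show "m x \<le> p x" for x
      using m(2) by (simp add: le_fun_def)
  qed
qed

section \<open>Subgradients of sums of convex functions\<close>

text \<open>\<open>E\<close> is to be thought of as the epigraph of a convex function that is bounded above near
  the origin and nonnegative at the origin.\<close>

lemma convex_epigraph_support:
  fixes E :: "('a::real_normed_vector \<times> real) set"
  assumes E: "convex E" and r: "r > 0" and ball: "\<And>z. norm z < r \<Longrightarrow> (z, M) \<in> E"
    and zero: "\<And>a. (0, a) \<in> E \<Longrightarrow> a \<ge> 0"
  obtains L :: "'a \<Rightarrow>\<^sub>L real" where "\<And>z a. (z, a) \<in> E \<Longrightarrow> blinfun_apply L z \<le> a"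
proof -
  \<comment> \<open>\<open>K z\<close> is the slice over \<open>z\<close> of the cone generated by
    \<open>E\<close>, and \<open>p\<close> is the lower boundary of that cone.\<close>
  define K where "K z = {a. \<exists>t>0. (t *\<^sub>R z, t * a) \<in> E}" for z
  define p where "p z = Inf (K z)" for z
  \<comment> \<open>The factor \<open>r / (2 * norm z)\<close> shrinks or stretches \<open>z\<close>
    to norm \<open>r / 2\<close>, inside the ball where height \<open>M\<close> is
    available.\<close>
  have K_ball: "2 * M / r * norm z \<in> K z" if "z \<noteq> 0" for z
    unfolding K_def using r that ball[of "(r / (2 * norm z)) *\<^sub>R z"]
    by (auto intro!: exI[of _ "r / (2 * norm z)"])
  have "M \<in> K 0"
    unfolding K_def using ball[of 0] r by (auto intro!: exI[of _ 1])
  with K_ball have K_ne: "K z \<noteq> {}" for z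
    by (cases "z = 0") auto
  have K_add: "a + b \<in> K (x + y)" if ab: "a \<in> K x" "b \<in> K y" for a b x y
  proof -
    obtain t s where t: "t > 0" "(t *\<^sub>R x, t * a) \<in> E" and s: "s > 0" "(s *\<^sub>R y, s * b) \<in> E"
      using ab by (auto simp: K_def)
    \<comment> \<open>These convex weights give \<open>x\<close> and \<open>y\<close> the common
      factor \<open>t * s / (t + s)\<close>.\<close>
    have "(s / (t + s)) *\<^sub>R (t *\<^sub>R x, t * a) + (t / (t + s)) *\<^sub>R (s *\<^sub>R y, s * b) \<in> E"
      using t s by (intro convexD[OF E]) (simp_all flip: add_divide_distrib add: add.commute)
    moreover have "(s / (t + s)) *\<^sub>R (t *\<^sub>R x, t * a) + (t / (t + s)) *\<^sub>R (s *\<^sub>R y, s * b) =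
        ((t * s / (t + s)) *\<^sub>R (x + y), t * s / (t + s) * (a + b))"
      by (simp add: algebra_simps add_divide_distrib)
    ultimately show ?thesis
      unfolding K_def using t(1) s(1) by (auto intro!: exI[of _ "t * s / (t + s)"])
  qed
  have K_scale: "s * a \<in> K (s *\<^sub>R x)" if a: "a \<in> K x" and s: "s > 0" for a s x
  proof -
    obtain t where "t > 0" "(t *\<^sub>R x, t * a) \<in> E"
      using a by (auto simp: K_def)
    then show ?thesis
      unfolding K_def using s by (auto intro!: exI[of _ "t / s"])
  qed
  have K_zero: "a \<ge> 0" if a: "a \<in> K 0" for a
  proof -
    obtain t where "t > 0" "(0, t * a) \<in> E"
      using a by (auto simp: K_def)
    then show ?thesis
      using zero[of "t * a"] by (simp add: zero_le_mult_iff)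
  qed
  have bdd: "bdd_below (K x)" for x
  proof -
    obtain b where "b \<in> K (- x)"
      using K_ne by blast
    \<comment> \<open>Adding a fixed \<open>b\<close> from the slice over \<open>- x\<close> lands
      in \<open>K 0\<close>, whose elements are nonnegative, so \<open>- b\<close> is a lower
      bound.\<close>
    then show ?thesis
      using K_add[of _ x b "- x"] K_zero by (intro bdd_belowI[of _ "- b"]) force
  qed
  have p_le: "p x \<le> a" if "a \<in> K x" for a x
    unfolding p_def using that bdd by (rule cInf_lower)
  have p_ge: "c \<le> p x" if "\<And>a. a \<in> K x \<Longrightarrow> c \<le> a" for c x
    unfolding p_def using K_ne that by (rule cInf_greatest)
  have "sublinear p"
  proof (rule sublinearI)
    fix x y
    have "p (x + y) - a \<le> p y" if "a \<in> K x" for a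
    proof (rule p_ge)
      fix b assume "b \<in> K y"
      with that show "p (x + y) - a \<le> b"
        using p_le[OF K_add, of a x b y] by simp
    qed
    then have "p (x + y) - p y \<le> p x"
      by (intro p_ge) (simp add: algebra_simps)
    then show "p (x + y) \<le> p x + p y"
      by simp
  next
    fix t :: real and x assume t: "t > 0"
    have "p (t *\<^sub>R x) / t \<le> p x"
      using p_le[OF K_scale[OF _ t]] t by (intro p_ge) (simp add: field_simps)
    with t show "p (t *\<^sub>R x) \<le> t * p x"
      by (simp add: field_simps)
  qed
  then obtain L where L: "linear L" and L_le: "\<And>x. L x \<le> p x"
    using Hahn_Banach_sublinear by blast
  \<comment> \<open>The ball in \<open>E\<close> yields continuity: this one-sided estimate at
    \<open>x\<close> and \<open>- x\<close> bounds the absolute value of \<open>L x\<close>.\<close>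
  have upper: "L x \<le> 2 * M / r * norm x" for x
    using L_le[of x] p_le[OF K_ball, of x] linear_0[OF L] by (cases "x = 0") auto
  have "bounded_linear L"
  proof (rule bounded_linear_intro)
    show "norm (L x) \<le> norm x * (2 * M / r)" for x
      using upper[of x] upper[of "- x"] linear_neg[OF L, of x] by (simp add: abs_le_iff mult.commute)
  qed (use L in \<open>auto simp: linear_add linear_scale\<close>)
  then have "blinfun_apply (Blinfun L) = L"
    by (rule bounded_linear_Blinfun_apply)
  moreover have "L z \<le> a" if "(z, a) \<in> E" for z a
  proof -
    have "a \<in> K z"
      unfolding K_def using that by (auto intro!: exI[of _ 1])
    then show ?thesis
      using L_le[of z] p_le by (meson order_trans)
  qed
  ultimately show ?thesis
    by (intro that[of "Blinfun L"]) simp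
qed

text \<open>Sum rule for two functions. The hypotheses are asymmetric: \<open>g\<close> is bounded
  above near \<open>u\<close>, while \<open>f\<close> merely has \<open>u\<close> in its domain, so
  \<open>C\<close> may be a constraint set without interior.\<close>

lemma convex_on_sum_subgradient:
  fixes f g :: "'a::real_normed_vector \<Rightarrow> real"
  assumes f: "convex_on C f" and g: "convex_on D g"
    and u: "u \<in> C" and r: "r > 0" and ball: "ball u r \<subseteq> D" and M: "\<And>y. y \<in> ball u r \<Longrightarrow> g y \<le> M"
    and xb: "xb \<in> C" "xb \<in> D" and min: "\<And>x. x \<in> C \<Longrightarrow> x \<in> D \<Longrightarrow> f xb + g xb \<le> f x + g x"
  obtains L :: "'a \<Rightarrow>\<^sub>L real" where "\<And>y. y \<in> D \<Longrightarrow> g xb + blinfun_apply L (y - xb) \<le> g y"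
    and "\<And>x. x \<in> C \<Longrightarrow> f xb \<le> f x + blinfun_apply L (x - xb)"
proof -
  \<comment> \<open>\<open>E\<close> is essentially the epigraph of \<open>z \<mapsto> inf\<^sub>x f x + g (x + z) - (f xb + g xb)\<close>, so a
    functional supporting it at the origin separates the two variables.\<close>
  define E where "E = {(y - x, a) |x y a. x \<in> C \<and> y \<in> D \<and> f x + g y - (f xb + g xb) \<le> a}"
  have "convex E"
  proof (rule convexI)
    fix e e' and s t :: real
    assume e: "e \<in> E" "e' \<in> E" and st: "0 \<le> s" "0 \<le> t" "s + t = 1"
    obtain x y a where 1: "e = (y - x, a)" "x \<in> C" "y \<in> D" "f x + g y - (f xb + g xb) \<le> a"
      using e(1) by (auto simp: E_def)
    obtain x' y' a' where 2: "e' = (y' - x', a')" "x' \<in> C" "y' \<in> D" "f x' + g y' - (f xb + g xb) \<le> a'"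
      using e(2) by (auto simp: E_def)
    have "f (s *\<^sub>R x + t *\<^sub>R x') \<le> s * f x + t * f x'"
      using f 1 2 st by (auto simp: convex_on_def)
    moreover have "g (s *\<^sub>R y + t *\<^sub>R y') \<le> s * g y + t * g y'"
      using g 1 2 st by (auto simp: convex_on_def)
    moreover have "s * (f x + g y - (f xb + g xb)) + t * (f x' + g y' - (f xb + g xb)) \<le> s * a + t * a'"
      using 1 2 st by (intro add_mono mult_left_mono) auto
    moreover have "s * (f xb + g xb) + t * (f xb + g xb) = f xb + g xb"
      using st(3) by (metis distrib_right mult_1)
    ultimately have "f (s *\<^sub>R x + t *\<^sub>R x') + g (s *\<^sub>R y + t *\<^sub>R y') - (f xb + g xb) \<le> s * a + t * a'"
      by (simp add: algebra_simps)
    moreover have "s *\<^sub>R x + t *\<^sub>R x' \<in> C" "s *\<^sub>R y + t *\<^sub>R y' \<in> D"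
      using convex_on_imp_convex[OF f] convex_on_imp_convex[OF g] 1 2 st by (auto intro: convexD)
    moreover have "s *\<^sub>R e + t *\<^sub>R e' = ((s *\<^sub>R y + t *\<^sub>R y') - (s *\<^sub>R x + t *\<^sub>R x'), s * a + t * a')"
      using 1(1) 2(1) by (simp add: algebra_simps)
    ultimately show "s *\<^sub>R e + t *\<^sub>R e' \<in> E"
      unfolding E_def by blast
  qed
  moreover have "(z, f u + M - (f xb + g xb)) \<in> E" if "norm z < r" for z
  proof -
    \<comment> \<open>Keeping the first point at \<open>u\<close> and moving only the second to
      \<open>u + z\<close> produces every small difference \<open>z\<close> at one fixed
      height.\<close>
    have "u + z \<in> ball u r"
      using that by (simp add: dist_norm)
    then show ?thesis
      unfolding E_def using ball M[of "u + z"] u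
      by (intro CollectI exI[of _ u] exI[of _ "u + z"] exI[of _ "f u + M - (f xb + g xb)"]) auto
  qed
  moreover have "a \<ge> 0" if "(0, a) \<in> E" for a
    using that min by (force simp: E_def)
  ultimately obtain L :: "'a \<Rightarrow>\<^sub>L real" where L: "\<And>z a. (z, a) \<in> E \<Longrightarrow> blinfun_apply L z \<le> a"
    using convex_epigraph_support[OF _ r] by metis
  have L': "blinfun_apply L (y - x) \<le> f x + g y - (f xb + g xb)" if "x \<in> C" "y \<in> D" for x y
    using that by (intro L) (auto simp: E_def)
  show ?thesis
  \<comment> \<open>Setting \<open>x = xb\<close> in \<open>L'\<close> isolates \<open>g\<close>;
    setting \<open>y = xb\<close> isolates \<open>f\<close>.\<close>
  proof (rule that)
    show "g xb + blinfun_apply L (y - xb) \<le> g y" if "y \<in> D" for y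
      using L'[OF xb(1) that] by simp
    show "f xb \<le> f x + blinfun_apply L (x - xb)" if "x \<in> C" for x
      using L'[OF that xb(2)] by (simp add: blinfun.diff_right)
  qed
qed

lemma convex_on_add_blinfun:
  fixes L :: "'a::real_normed_vector \<Rightarrow>\<^sub>L real"
  assumes "convex_on C f"
  shows "convex_on C (\<lambda>x. f x + blinfun_apply L (x - c))"
proof (rule convex_on_add[OF assms])
  have "s * blinfun_apply L c + t * blinfun_apply L c = blinfun_apply L c" if "s + t = 1" for s t :: real
    using that by (metis distrib_right mult_1)
  then show "convex_on C (\<lambda>x. blinfun_apply L (x - c))"
    using convex_on_imp_convex[OF assms]
    by (auto simp: convex_on_def blinfun.bilinear_simps algebra_simps)
qed

lemma convex_on_sum_functions:
  assumes "convex C" "\<And>i. i \<in> I \<Longrightarrow> convex_on C (g i)"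
  shows "convex_on C (\<lambda>x. \<Sum>i\<in>I. g i x)"
  using assms(2)
proof (induction I rule: infinite_finite_induct)
  case (insert i I)
  then have "convex_on C (\<lambda>x. g i x + (\<Sum>j\<in>I. g j x))"
    by (intro convex_on_add) auto
  with insert.hyps show ?case
    by simp
qed (use assms(1) in \<open>simp_all add: convex_on_const\<close>)

text \<open>The subgradient obtained for one summand is a linear term that the induction absorbs
  into \<open>f\<close>.\<close>

lemma convex_on_finite_sum_subgradient:
  fixes g :: "'i \<Rightarrow> 'a::real_normed_vector \<Rightarrow> real"
  assumes "finite I" and "convex_on C f" and "\<And>i. i \<in> I \<Longrightarrow> convex_on (D i) (g i)"
    and "u \<in> C"
    and "\<And>i. i \<in> I \<Longrightarrow> \<exists>r>0. \<exists>M. ball u r \<subseteq> D i \<and> (\<forall>y\<in>ball u r. g i y \<le> M)"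
    and "xb \<in> C" and "\<And>i. i \<in> I \<Longrightarrow> xb \<in> D i"
    and "\<And>x. x \<in> C \<Longrightarrow> (\<And>i. i \<in> I \<Longrightarrow> x \<in> D i) \<Longrightarrow> f xb + (\<Sum>i\<in>I. g i xb) \<le> f x + (\<Sum>i\<in>I. g i x)"
  shows "\<exists>L :: 'i \<Rightarrow> 'a \<Rightarrow>\<^sub>L real. (\<forall>i\<in>I. \<forall>y\<in>D i. g i xb + blinfun_apply (L i) (y - xb) \<le> g i y) \<and>
           (\<forall>x\<in>C. f xb \<le> f x + (\<Sum>i\<in>I. blinfun_apply (L i) (x - xb)))"
  using assms
proof (induction I arbitrary: f rule: finite_induct)
  case empty
  then show ?case by auto
next
  case (insert j I)
  \<comment> \<open>All summands except \<open>g j\<close> are merged with \<open>f\<close>, so that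
    the rule for two functions splits off \<open>g j\<close>.\<close>
  let ?C = "C \<inter> (\<Inter>i\<in>I. D i)" and ?f = "\<lambda>x. f x + (\<Sum>i\<in>I. g i x)"
  have "u \<in> D i" if "i \<in> I" for i
    using insert.prems(4)[of i] that by (meson centre_in_ball insertI2 subsetD)
  then have u: "u \<in> ?C"
    using insert.prems(3) by auto
  have C: "convex ?C"
    using insert.prems(1,2) by (auto intro!: convex_Int convex_INT dest: convex_on_imp_convex)
  have conv: "convex_on ?C ?f"
  proof (rule convex_on_add)
    show "convex_on ?C f"
      using insert.prems(1) _ C by (rule convex_on_subset) auto
    have "convex_on ?C (g i)" if "i \<in> I" for i
      using insert.prems(2)[of i] that C by (auto intro: convex_on_subset)
    then show "convex_on ?C (\<lambda>x. \<Sum>i\<in>I. g i x)"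
      using C by (intro convex_on_sum_functions)
  qed
  obtain r M where r: "r > 0" "ball u r \<subseteq> D j" "\<And>y. y \<in> ball u r \<Longrightarrow> g j y \<le> M"
    using insert.prems(4)[of j] by blast
  have xb: "xb \<in> ?C" "xb \<in> D j"
    using insert.prems(5,6) by auto
  have min: "?f xb + g j xb \<le> ?f x + g j x" if "x \<in> ?C" "x \<in> D j" for x
  proof -
    have "x \<in> C" "\<And>i. i \<in> insert j I \<Longrightarrow> x \<in> D i"
      using that by auto
    from insert.prems(7)[OF this] show ?thesis
      using insert.hyps by simp
  qed
  obtain Lj :: "'a \<Rightarrow>\<^sub>L real"
    where Lj: "\<And>y. y \<in> D j \<Longrightarrow> g j xb + blinfun_apply Lj (y - xb) \<le> g j y"
      and Lj': "\<And>x. x \<in> ?C \<Longrightarrow> ?f xb \<le> ?f x + blinfun_apply Lj (x - xb)"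
    using convex_on_sum_subgradient[OF conv insert.prems(2)[OF insertI1] u r xb min] by blast
  \<comment> \<open>The induction hypothesis is applied to \<open>f\<close> plus the linear term of
    \<open>Lj\<close>; by \<open>Lj'\<close>, \<open>xb\<close> remains a minimizer. The vanishing
    term at \<open>xb - xb\<close> is kept to match its form.\<close>
  have "\<exists>L :: 'i \<Rightarrow> 'a \<Rightarrow>\<^sub>L real. (\<forall>i\<in>I. \<forall>y\<in>D i. g i xb + blinfun_apply (L i) (y - xb) \<le> g i y) \<and>
      (\<forall>x\<in>C. f xb + blinfun_apply Lj (xb - xb) \<le>
         f x + blinfun_apply Lj (x - xb) + (\<Sum>i\<in>I. blinfun_apply (L i) (x - xb)))"
    using insert.prems Lj'
    by (intro insert.IH convex_on_add_blinfun) (auto simp: algebra_simps)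
  then obtain L :: "'i \<Rightarrow> 'a \<Rightarrow>\<^sub>L real"
    where L: "\<And>i y. i \<in> I \<Longrightarrow> y \<in> D i \<Longrightarrow> g i xb + blinfun_apply (L i) (y - xb) \<le> g i y"
      and L': "\<And>x. x \<in> C \<Longrightarrow> f xb \<le> f x + blinfun_apply Lj (x - xb) + (\<Sum>i\<in>I. blinfun_apply (L i) (x - xb))"
    by auto
  have "(\<Sum>i\<in>insert j I. blinfun_apply ((L(j := Lj)) i) z) =
      blinfun_apply Lj z + (\<Sum>i\<in>I. blinfun_apply (L i) z)" for z
    using insert.hyps by (auto intro!: sum.cong)
  then show ?case
    using L L' Lj insert.hyps(2) by (intro exI[of _ "L(j := Lj)"]) (auto simp: add.assoc)
qed

section \<open>The minimal time function\<close>

lemma min_time_le: "0 \<le> t \<Longrightarrow> x + t *\<^sub>R v \<in> \<Omega> \<Longrightarrow> min_time v \<Omega> x \<le> ereal t"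
  unfolding min_time_def by (rule Inf_lower) auto

lemma min_time_nonneg: "0 \<le> min_time v \<Omega> x"
  unfolding min_time_def by (rule Inf_greatest) auto

lemma ereal_real_min_time: "min_time v \<Omega> x < \<infinity> \<Longrightarrow> ereal (real_of_ereal (min_time v \<Omega> x)) = min_time v \<Omega> x"
  using min_time_nonneg[of v \<Omega> x] by (cases "min_time v \<Omega> x") auto

lemma real_min_time_nonneg: "0 \<le> real_of_ereal (min_time v \<Omega> x)"
  using min_time_nonneg by (rule real_of_ereal_pos)

lemma real_min_time_le:
  assumes "0 \<le> t" "x + t *\<^sub>R v \<in> \<Omega>"
  shows "min_time v \<Omega> x < \<infinity>" and "real_of_ereal (min_time v \<Omega> x) \<le> t"
proof -
  show fin: "min_time v \<Omega> x < \<infinity>"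
    using min_time_le[OF assms] by (rule order.strict_trans1) simp
  show "real_of_ereal (min_time v \<Omega> x) \<le> t"
    using min_time_le[OF assms] ereal_real_min_time[OF fin] by (metis ereal_less_eq(3))
qed

text \<open>The infimum is attained: the admissible times form a closed set bounded below, nonempty
  because the infimum is finite.\<close>

lemma hit_point_in:
  assumes "closed \<Omega>" and fin: "min_time v \<Omega> x < \<infinity>"
  shows "hit_point v \<Omega> x \<in> \<Omega>"
proof -
  define S where "S = {0..} \<inter> (\<lambda>t. x + t *\<^sub>R v) -` \<Omega>"
  have eq: "min_time v \<Omega> x = (INF t\<in>S. ereal t)"
    unfolding min_time_def S_def by (rule arg_cong[where f = Inf]) auto
  have ne: "S \<noteq> {}"
    using fin by (auto simp: eq top_ereal_def)
  have bdd: "bdd_below S"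
    by (auto simp: S_def intro!: bdd_belowI[of _ 0])
  have "closed S"
    unfolding S_def using \<open>closed \<Omega>\<close>
    by (intro closed_Int closed_vimage continuous_intros) auto
  with ne bdd have "Inf S \<in> S"
    by (intro closed_contains_Inf)
  moreover have "real_of_ereal (min_time v \<Omega> x) = Inf S"
    unfolding eq ereal_Inf'[OF bdd ne, symmetric] by simp
  ultimately show ?thesis
    by (simp add: S_def hit_point_def)
qed

text \<open>The convex combination of two hit points lies in the target set and is reached from the
  combined starting point in the combined time.\<close>

lemma convex_on_min_time:
  assumes "closed \<Omega>" "convex \<Omega>"
  shows "convex_on {x. min_time v \<Omega> x < \<infinity>} (\<lambda>x. real_of_ereal (min_time v \<Omega> x))"
proof -
  let ?T = "\<lambda>x. real_of_ereal (min_time v \<Omega> x)"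
  have key: "min_time v \<Omega> (s *\<^sub>R x + t *\<^sub>R y) < \<infinity>" "?T (s *\<^sub>R x + t *\<^sub>R y) \<le> s * ?T x + t * ?T y"
    if st: "0 \<le> s" "0 \<le> t" "s + t = 1" and xy: "min_time v \<Omega> x < \<infinity>" "min_time v \<Omega> y < \<infinity>" for s t x y
  proof -
    have "s *\<^sub>R hit_point v \<Omega> x + t *\<^sub>R hit_point v \<Omega> y \<in> \<Omega>"
      using assms st xy by (intro convexD hit_point_in)
    then have "(s *\<^sub>R x + t *\<^sub>R y) + (s * ?T x + t * ?T y) *\<^sub>R v \<in> \<Omega>"
      by (simp add: hit_point_def algebra_simps)
    moreover have "0 \<le> s * ?T x + t * ?T y"
      using st real_min_time_nonneg[of v \<Omega>] by simp
    ultimately show "min_time v \<Omega> (s *\<^sub>R x + t *\<^sub>R y) < \<infinity>" "?T (s *\<^sub>R x + t *\<^sub>R y) \<le> s * ?T x + t * ?T y"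
      using real_min_time_le by blast+
  qed
  show ?thesis
    unfolding convex_on_def
  proof
    show "convex {x. min_time v \<Omega> x < \<infinity>}"
      using key(1) by (intro convexI) simp
  qed (use key(2) in auto)
qed

text \<open>Turns continuity at \<open>u\<close> into the local upper bound required by the sum
  rule; any real \<open>M\<close> above the value at \<open>u\<close> will do.\<close>

lemma min_time_bounded_near:
  assumes fin: "min_time v \<Omega> u < \<infinity>" and cont: "isCont (min_time v \<Omega>) u"
  shows "\<exists>r>0. \<exists>M. ball u r \<subseteq> {x. min_time v \<Omega> x < \<infinity>} \<and>
           (\<forall>y\<in>ball u r. real_of_ereal (min_time v \<Omega> y) \<le> M)"
proof -
  obtain M where M: "min_time v \<Omega> u < ereal M"
    using ereal_dense2[OF fin] by auto
  have "\<forall>\<^sub>F x in nhds u. min_time v \<Omega> x < ereal M"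
    using cont M unfolding isCont_def tendsto_at_iff_tendsto_nhds by (rule order_tendstoD(2))
  then obtain r where r: "r > 0" "\<And>x. x \<in> ball u r \<Longrightarrow> min_time v \<Omega> x < ereal M"
    by (auto simp: eventually_nhds_metric dist_commute)
  have "min_time v \<Omega> x < \<infinity> \<and> real_of_ereal (min_time v \<Omega> x) \<le> M" if "x \<in> ball u r" for x
  proof -
    have fin: "min_time v \<Omega> x < \<infinity>"
      using r(2)[OF that] by (rule order.strict_trans) simp
    then show ?thesis
      using r(2)[OF that] ereal_real_min_time[OF fin] by (metis ereal_less_eq(3) less_imp_le)
  qed
  then show ?thesis
    using r(1) by blast
qed

section \<open>Subgradients of the minimal time function\<close>

lemma min_time_subgradientD:
  fixes L :: "'a::real_normed_vector \<Rightarrow>\<^sub>L real"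
  defines "T \<equiv> \<lambda>v \<Omega> x. real_of_ereal (min_time v \<Omega> x)"
  assumes "closed \<Omega>" and fin: "min_time v \<Omega> x < \<infinity>"
    and sub: "\<And>y. min_time v \<Omega> y < \<infinity> \<Longrightarrow> T v \<Omega> x + blinfun_apply L (y - x) \<le> T v \<Omega> y"
  shows "L \<in> normal_cone (hit_point v \<Omega> x) \<Omega>"
    and "blinfun_apply L (- v) \<le> 1"
    and "x \<notin> \<Omega> \<Longrightarrow> blinfun_apply L v = -1"
proof -
  have le: "T v \<Omega> x + blinfun_apply L (y - x) \<le> t" if "0 \<le> t" "y + t *\<^sub>R v \<in> \<Omega>" for y t
    using sub[of y] real_min_time_le[OF that] by (simp add: T_def)
  have nonneg: "0 \<le> T v \<Omega> x"
    by (simp add: T_def real_min_time_nonneg)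
  have hit: "x + T v \<Omega> x *\<^sub>R v \<in> \<Omega>"
    using hit_point_in[OF \<open>closed \<Omega>\<close> fin] by (simp add: hit_point_def T_def)
  show "L \<in> normal_cone (hit_point v \<Omega> x) \<Omega>"
    unfolding normal_cone_def
  proof safe
    fix w assume "w \<in> \<Omega>"
    then show "blinfun_apply L (w - hit_point v \<Omega> x) \<le> 0"
      \<comment> \<open>The test point reaches \<open>w\<close> in time
        \<open>T v \<Omega> x\<close>, and its difference from \<open>x\<close> is exactly
        \<open>w\<close> minus the hit point.\<close>
      using le[of "T v \<Omega> x" "w - T v \<Omega> x *\<^sub>R v"] nonneg
      by (simp add: hit_point_def T_def algebra_simps)
  qed
  show ge: "blinfun_apply L (- v) \<le> 1"
    \<comment> \<open>Starting one step further back, at \<open>x - v\<close>, the hit point of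
      \<open>x\<close> is reached one time unit later.\<close>
    using le[of "T v \<Omega> x + 1" "x - v"] nonneg hit by (simp add: algebra_simps)
  show "blinfun_apply L v = -1" if "x \<notin> \<Omega>"
  proof -
    have "T v \<Omega> x > 0"
      using nonneg hit that by (cases "T v \<Omega> x = 0") auto
    \<comment> \<open>The hit point itself has travel time 0. Dividing by the positive time of
      \<open>x\<close> gives the bound opposite to \<open>ge\<close>.\<close>
    moreover have "T v \<Omega> x * (1 + blinfun_apply L v) \<le> 0"
      using le[of 0 "x + T v \<Omega> x *\<^sub>R v"] hit by (simp add: blinfun.scaleR_right algebra_simps)
    ultimately show ?thesis
      using ge by (simp add: blinfun.minus_right mult_le_0_iff)
  qed
qed

text \<open>The normal cone inequality at the hit point of \<open>y\<close> leaves the term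
  \<open>(t - s) * blinfun_apply L v\<close>. It equals \<open>s - t\<close> if \<open>x\<close>
  lies outside the set; inside, \<open>s = 0\<close> and the term is at least
  \<open>- t\<close>.\<close>

lemma min_time_subgradientI:
  fixes L :: "'a::real_normed_vector \<Rightarrow>\<^sub>L real"
  assumes "closed \<Omega>" and normal: "L \<in> normal_cone (hit_point v \<Omega> x) \<Omega>"
    and inner: "x \<in> \<Omega> \<Longrightarrow> blinfun_apply L (- v) \<le> 1"
    and outer: "x \<notin> \<Omega> \<Longrightarrow> blinfun_apply L v = -1"
    and fin: "min_time v \<Omega> y < \<infinity>"
  shows "real_of_ereal (min_time v \<Omega> x) + blinfun_apply L (y - x) \<le> real_of_ereal (min_time v \<Omega> y)"
proof -
  define s t where "s = real_of_ereal (min_time v \<Omega> x)" and "t = real_of_ereal (min_time v \<Omega> y)"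
  have "t \<ge> 0"
    by (simp add: t_def real_min_time_nonneg)
  have "blinfun_apply L (hit_point v \<Omega> y - hit_point v \<Omega> x) \<le> 0"
    using normal hit_point_in[OF \<open>closed \<Omega>\<close> fin] by (simp add: normal_cone_def)
  then have *: "blinfun_apply L (y - x) + (t - s) * blinfun_apply L v \<le> 0"
    by (simp add: hit_point_def s_def t_def blinfun.bilinear_simps algebra_simps)
  show ?thesis
  proof (cases "x \<in> \<Omega>")
    case True
    then have "s \<le> 0"
      unfolding s_def by (intro real_min_time_le(2)) auto
    then have "s = 0"
      unfolding s_def using real_min_time_nonneg by (rule antisym)
    moreover have "t * blinfun_apply L (- v) \<le> t * 1"
      using inner[OF True] \<open>t \<ge> 0\<close> by (rule mult_left_mono)
    ultimately show ?thesis
      using * by (simp add: blinfun.minus_right flip: s_def t_def)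
  next
    case False
    then show ?thesis
      using * outer by (simp flip: s_def t_def)
  qed
qed

section \<open>Necessary and sufficient optimality conditions\<close>

lemma eff_dom_total_time_iff:
  "x \<in> eff_dom (total_time n v \<Omega>) \<longleftrightarrow> (\<forall>i\<in>{1..n}. min_time (v i) (\<Omega> i) x < \<infinity>)"
  by (simp add: eff_dom_def total_time_def sum_Pinfty less_top top_ereal_def)

lemma total_time_eq:
  assumes "x \<in> eff_dom (total_time n v \<Omega>)"
  shows "total_time n v \<Omega> x = ereal (\<Sum>i=1..n. real_of_ereal (min_time (v i) (\<Omega> i) x))"
  using assms unfolding eff_dom_total_time_iff total_time_def sum_ereal[symmetric]
  by (intro sum.cong) (auto simp: ereal_real_min_time)

lemma multiplier_conditionsI:
  fixes n :: nat and \<Omega> :: "nat \<Rightarrow> 'a::real_normed_vector set"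
  assumes closed: "\<And>i. i \<in> {1..n} \<Longrightarrow> closed (\<Omega> i)"
    and convex: "\<And>i. i \<in> {0..n} \<Longrightarrow> convex (\<Omega> i)"
    and u: "u \<in> eff_dom (total_time n v \<Omega>)" "u \<in> \<Omega> 0"
    and cont: "\<And>i. i \<in> {1..n} \<Longrightarrow> isCont (min_time (v i) (\<Omega> i)) u"
    and opt: "optimal_solution (total_time n v \<Omega>) (\<Omega> 0) xbar"
  shows "\<exists>x' :: nat \<Rightarrow> 'a \<Rightarrow>\<^sub>L real. multiplier_conditions n v \<Omega> xbar x'"
proof -
  define T where "T i x = real_of_ereal (min_time (v i) (\<Omega> i) x)" for i x
  define D where "D i = {x. min_time (v i) (\<Omega> i) x < \<infinity>}" for i
  have dom: "x \<in> eff_dom (total_time n v \<Omega>) \<longleftrightarrow> (\<forall>i\<in>{1..n}. x \<in> D i)" for x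
    by (simp add: eff_dom_total_time_iff D_def)
  have total: "total_time n v \<Omega> x = ereal (\<Sum>i=1..n. T i x)" if "\<And>i. i \<in> {1..n} \<Longrightarrow> x \<in> D i" for x
    unfolding T_def using that dom by (intro total_time_eq) blast
  have xbar: "xbar \<in> \<Omega> 0" and min: "total_time n v \<Omega> xbar \<le> total_time n v \<Omega> x" if "x \<in> \<Omega> 0" for x
    using opt that by (auto simp: optimal_solution_def is_arg_min_def not_less)
  \<comment> \<open>Comparing with the feasible point \<open>u\<close> of finite total time makes
    every summand finite at \<open>xbar\<close>.\<close>
  have xbar_dom: "xbar \<in> D i" if "i \<in> {1..n}" for i
    using min[OF u(2)] u(1) dom[of xbar] that by (auto simp: eff_dom_def)
  have "\<exists>L :: nat \<Rightarrow> 'a \<Rightarrow>\<^sub>L real.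
      (\<forall>i\<in>{1..n}. \<forall>y\<in>D i. T i xbar + blinfun_apply (L i) (y - xbar) \<le> T i y) \<and>
      (\<forall>x\<in>\<Omega> 0. 0 \<le> 0 + (\<Sum>i=1..n. blinfun_apply (L i) (x - xbar)))"
  \<comment> \<open>The sum rule is used with the zero function on \<open>\<Omega> 0\<close>: the
    constraint enters through the domain, and the last inequality becomes condition (3).\<close>
  proof (rule convex_on_finite_sum_subgradient)
    show "convex_on (\<Omega> 0) (\<lambda>_. 0)"
      using convex[of 0] by (simp add: convex_on_const)
    show "convex_on (D i) (T i)" if "i \<in> {1..n}" for i
      unfolding D_def T_def using closed[of i] convex[of i] that by (intro convex_on_min_time) auto
    show "\<exists>r>0. \<exists>M. ball u r \<subseteq> D i \<and> (\<forall>y\<in>ball u r. T i y \<le> M)" if "i \<in> {1..n}" for i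
      unfolding D_def T_def using that cont u(1)
      by (intro min_time_bounded_near) (auto simp: eff_dom_total_time_iff)
    show "0 + (\<Sum>i=1..n. T i xbar) \<le> 0 + (\<Sum>i=1..n. T i x)"
      if "x \<in> \<Omega> 0" "\<And>i. i \<in> {1..n} \<Longrightarrow> x \<in> D i" for x
      using min[OF that(1)] total[OF that(2)] total[OF xbar_dom] by simp
  qed (use u xbar xbar_dom in auto)
  then obtain L :: "nat \<Rightarrow> 'a \<Rightarrow>\<^sub>L real"
    where L: "\<And>i y. i \<in> {1..n} \<Longrightarrow> y \<in> D i \<Longrightarrow> T i xbar + blinfun_apply (L i) (y - xbar) \<le> T i y"
      and L0: "\<And>x. x \<in> \<Omega> 0 \<Longrightarrow> 0 \<le> (\<Sum>i=1..n. blinfun_apply (L i) (x - xbar))"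
    unfolding add_0 by blast
  have "L i \<in> normal_cone (hit_point (v i) (\<Omega> i) xbar) (\<Omega> i)"
      "blinfun_apply (L i) (- v i) \<le> 1" "xbar \<notin> \<Omega> i \<Longrightarrow> blinfun_apply (L i) (v i) = -1"
    if i: "i \<in> {1..n}" for i
    using min_time_subgradientD[OF closed[OF i], of "v i" xbar "L i"] L[OF i] xbar_dom[OF i]
    by (auto simp: D_def T_def)
  moreover have "- (\<Sum>i=1..n. L i) \<in> normal_cone xbar (\<Omega> 0)"
    using L0 by (simp add: normal_cone_def blinfun.minus_left blinfun.sum_left)
  ultimately have "multiplier_conditions n v \<Omega> xbar L"
    by (auto simp: multiplier_conditions_def idx_in_def idx_out_def)
  then show ?thesis
    by (rule exI[of _ L])
qed

lemma multiplier_conditions_imp_optimal: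
  assumes closed: "\<And>i. i \<in> {1..n} \<Longrightarrow> closed (\<Omega> i)"
    and xbar: "xbar \<in> eff_dom (total_time n v \<Omega>)" "xbar \<in> \<Omega> 0"
    and mult: "multiplier_conditions n v \<Omega> xbar x'"
  shows "optimal_solution (total_time n v \<Omega>) (\<Omega> 0) xbar"
proof -
  let ?T = "\<lambda>i x. real_of_ereal (min_time (v i) (\<Omega> i) x)"
  have "total_time n v \<Omega> xbar \<le> total_time n v \<Omega> y" if y: "y \<in> \<Omega> 0" for y
  proof (cases "y \<in> eff_dom (total_time n v \<Omega>)")
    case True
    have "?T i xbar + blinfun_apply (x' i) (y - xbar) \<le> ?T i y" if i: "i \<in> {1..n}" for i
      using closed[OF i] mult True i
      by (intro min_time_subgradientI)
        (auto simp: multiplier_conditions_def idx_in_def idx_out_def eff_dom_total_time_iff)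
    then have "(\<Sum>i=1..n. ?T i xbar + blinfun_apply (x' i) (y - xbar)) \<le> (\<Sum>i=1..n. ?T i y)"
      by (rule sum_mono)
    moreover have "0 \<le> (\<Sum>i=1..n. blinfun_apply (x' i) (y - xbar))"
      using mult y
      by (simp add: multiplier_conditions_def normal_cone_def blinfun.minus_left blinfun.sum_left)
    ultimately show ?thesis
      using total_time_eq[OF True] total_time_eq[OF xbar(1)] by (simp add: sum.distrib)
  next
    case False
    then show ?thesis
      by (simp add: eff_dom_def)
  qed
  with xbar(2) show ?thesis
    by (auto simp: optimal_solution_def is_arg_min_def not_less)
qed

theorem theorem5p4:
  fixes n :: nat
    and \<Omega> :: "nat \<Rightarrow> 'a::real_normed_vector set"
    and v :: "nat \<Rightarrow> 'a"
  assumes "\<And>i. i \<in> {0..n} \<Longrightarrow> \<Omega> i \<noteq> {}"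
    and "\<And>i. i \<in> {0..n} \<Longrightarrow> closed (\<Omega> i)"
    and "\<And>i. i \<in> {0..n} \<Longrightarrow> convex (\<Omega> i)"
    and "\<And>i. i \<in> {1..n} \<Longrightarrow> v i \<noteq> 0"
    and "\<exists>u \<in> eff_dom (total_time n v \<Omega>) \<inter> \<Omega> 0.
           \<forall>i\<in>{1..n}. isCont (min_time (v i) (\<Omega> i)) u"
  shows "(\<forall>xbar. optimal_solution (total_time n v \<Omega>) (\<Omega> 0) xbar \<longrightarrow>
            (\<exists>x' :: nat \<Rightarrow> 'a \<Rightarrow>\<^sub>L real. multiplier_conditions n v \<Omega> xbar x')) \<and>
         (\<forall>xbar \<in> eff_dom (total_time n v \<Omega>) \<inter> \<Omega> 0.
            (\<exists>x' :: nat \<Rightarrow> 'a \<Rightarrow>\<^sub>L real. multiplier_conditions n v \<Omega> xbar x') \<longrightarrow>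
            optimal_solution (total_time n v \<Omega>) (\<Omega> 0) xbar)"
proof (intro conjI allI impI ballI)
  fix xbar
  assume "optimal_solution (total_time n v \<Omega>) (\<Omega> 0) xbar"
  with assms(2,3,5) show "\<exists>x' :: nat \<Rightarrow> 'a \<Rightarrow>\<^sub>L real. multiplier_conditions n v \<Omega> xbar x'"
    by (auto intro: multiplier_conditionsI)
next
  fix xbar
  assume "xbar \<in> eff_dom (total_time n v \<Omega>) \<inter> \<Omega> 0"
    and "\<exists>x' :: nat \<Rightarrow> 'a \<Rightarrow>\<^sub>L real. multiplier_conditions n v \<Omega> xbar x'"
  with assms(2) show "optimal_solution (total_time n v \<Omega>) (\<Omega> 0) xbar"
    by (auto intro: multiplier_conditions_imp_optimal)
qed

end
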